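(* Let $(G,v_G)$ and $(H,v_H)$ be rooted graphs and let $g,h\ge 0$, $m\ge 2$ be integers. Let $K_m^{gh}(G,H)$ be the graph obtained from the disjoint union of $G$, $H$ and a complete graph $K_m$ with two distinct chosen vertices $x,y$ by adding a path of length $g$ joining $v_G$ and $x$ and a path of length $h$ joining $y$ and $v_H$ (a path of length $0$ meaning identification of its ends). Then \[ \frac{X_{K_m^{gh}(G,H)}}{(m-2)!}=\sum_{z=1}^{m-1}z\,e_{m-1-z}\,X_{P^{g+h+z}(G,H)}+(m-2)\sum_{\substack{a+b+c=m-2\\ a,b,c\ge 0}}(a-1)\,e_a\,X_{G^{b+g}}\,X_{H^{c+h}}. \]
   Context: All graphs are finite simple graphs. The chromatic symmetric function of a graph $G$ is $X_G=\sum_{\kappa}\prod_{v\in V(G)}x_{\kappa(v)}$, where $\kappa$ ranges over proper colorings $\kappa:V(G)\to\{1,2,\dots\}$; $e_a$ is the $a$-th elementary symmetric function, $e_0=1$. For rooted graphs $(G,u)$, $(H,v)$ and $k\ge0$, $P^k(G,H)$ is obtained from the disjoint union of $G$ and $H$ by adding a path of length $k$ (with $k-1$ new internal vertices) joining $u$ and $v$ (for $k=0$ identifying them), and $G^k=P^k(G,K_1)$ is $G$ with a pendant path of length $k$ at its root. *)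

theory Defs
  imports Complex_Main "HOL-Library.Poly_Mapping" "HOL-Library.FuncSet"
begin

type_synonym 'a graph = "'a set \<times> 'a set set"

definition simple_graph :: "'a graph \<Rightarrow> bool" where
  "simple_graph G \<longleftrightarrow> finite (fst G) \<and> (\<forall>e\<in>snd G. e \<subseteq> fst G \<and> card e = 2)"

definition gmap :: "('a \<Rightarrow> 'b) \<Rightarrow> 'a graph \<Rightarrow> 'b graph" where
  "gmap f G = (f ` fst G, (\<lambda>e. f ` e) ` snd G)"

definition gunion :: "'a graph \<Rightarrow> 'a graph \<Rightarrow> 'a graph" where
  "gunion G H = (fst G \<union> fst H, snd G \<union> snd H)"

definition path_graph :: "'a list \<Rightarrow> 'a graph" where
  "path_graph ps = (set ps, {{ps ! i, ps ! Suc i} | i. Suc i < length ps})"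

text \<open>P^k(G,H) for rooted graphs (G,u), (H,v): disjoint union plus a path of
  length k from u to v (k-1 new internal vertices Inr 1 .. Inr (k-1));
  for k = 0 the roots are identified.\<close>
definition Pk :: "nat \<Rightarrow> 'a graph \<Rightarrow> 'a \<Rightarrow> 'b graph \<Rightarrow> 'b \<Rightarrow> (('a + 'b) + nat) graph" where
  "Pk k G u H v =
    (let eG = (\<lambda>a. Inl (Inl a));
         eH = (\<lambda>b. if k = 0 \<and> b = v then Inl (Inl u) else Inl (Inr b));
         p = (\<lambda>i. if i = 0 then eG u else if i = k then eH v else Inr i)
     in gunion (gunion (gmap eG G) (gmap eH H)) (path_graph (map p [0..<Suc k])))"

definition K1 :: "unit graph" where "K1 = ({()}, {})"

definition pendant :: "nat \<Rightarrow> 'a graph \<Rightarrow> 'a \<Rightarrow> (('a + unit) + nat) graph" where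
  "pendant k G u = Pk k G u K1 ()"

text \<open>K_m^{gh}(G,H): K_m has vertices 0..m-1, with x = 0 and y = 1; a path of
  length g joins v_G and x, a path of length h joins y and v_H (length 0 means
  identification).\<close>
definition Kmgh :: "nat \<Rightarrow> nat \<Rightarrow> nat \<Rightarrow> 'a graph \<Rightarrow> 'a \<Rightarrow> 'b graph \<Rightarrow> 'b
    \<Rightarrow> (('a + 'b) + (nat + (nat + nat))) graph" where
  "Kmgh m g h G vG H vH =
    (let eG = (\<lambda>a. Inl (Inl a));
         eH = (\<lambda>b. Inl (Inr b));
         eK = (\<lambda>j. if j = 0 \<and> g = 0 then eG vG
                   else if j = 1 \<and> h = 0 then eH vH else Inr (Inl j));
         p1 = (\<lambda>i. if i = 0 then eG vG else if i = g then eK 0 else Inr (Inr (Inl i)));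
         p2 = (\<lambda>i. if i = 0 then eK 1 else if i = h then eH vH else Inr (Inr (Inr i)));
         Km = (eK ` {0..<m}, {{eK i, eK j} | i j. i < m \<and> j < m \<and> i \<noteq> j})
     in gunion (gunion (gunion (gmap eG G) (gmap eH H)) Km)
          (gunion (path_graph (map p1 [0..<Suc g])) (path_graph (map p2 [0..<Suc h]))))"

text \<open>A series is given by its coefficient function on monomials
  x^alpha, alpha a finitely supported exponent vector.\<close>
type_synonym sf = "(nat \<Rightarrow>\<^sub>0 nat) \<Rightarrow> rat"

definition sf_mult :: "sf \<Rightarrow> sf \<Rightarrow> sf" where
  "sf_mult f g = (\<lambda>\<alpha>. \<Sum>(\<beta>, \<gamma>) \<in> {(\<beta>, \<gamma>). \<beta> + \<gamma> = \<alpha>}. f \<beta> * g \<gamma>)"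

definition elem :: "nat \<Rightarrow> sf" where
  "elem a = (\<lambda>\<alpha>. if (\<forall>i. Poly_Mapping.lookup \<alpha> i \<le> 1) \<and> (\<Sum>i\<in>Poly_Mapping.keys \<alpha>. Poly_Mapping.lookup \<alpha> i) = a then 1 else 0)"

definition proper_coloring :: "'a graph \<Rightarrow> ('a \<Rightarrow> nat) \<Rightarrow> bool" where
  "proper_coloring G \<kappa> \<longleftrightarrow> (\<forall>e\<in>snd G. \<forall>u\<in>e. \<forall>w\<in>e. u \<noteq> w \<longrightarrow> \<kappa> u \<noteq> \<kappa> w)"

definition csf :: "'a graph \<Rightarrow> sf" where
  "csf G = (\<lambda>\<alpha>. of_nat (card {\<kappa> \<in> fst G \<rightarrow>\<^sub>E (UNIV :: nat set).
       proper_coloring G \<kappa> \<and> (\<forall>i. card {v \<in> fst G. \<kappa> v = i} = Poly_Mapping.lookup \<alpha> i)}))"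

end

theory Submission
  imports Defs "HOL-Computational_Algebra.Formal_Power_Series"
begin

text \<open>
  Only the finitely many colours occurring in a monomial matter for its coefficient, so one may work
  with polynomials over a finite colour set \<open>C\<close>. To a rooted graph attach the vector \<open>a\<close> whose entry
  \<open>a c\<close> is the weight of the proper colourings with root colour \<open>c\<close>. Lengthening the path at the root
  by one edge applies the linear operator \<open>L a = (\<lambda>c. x c * (\<Sum>a - a c))\<close>, so with \<open>a\<close>, \<open>b\<close> the
  vectors of the graphs \<open>G\<^sup>g\<close>, \<open>H\<^sup>h\<close> everything is bilinear in \<open>a\<close> and \<open>b\<close>: the pendant graphs give
  \<open>\<Sum>(L\<^sup>k a)\<close>, the joined ones \<open>\<Sum>\<^bsub>c \<noteq> d\<^esub> (L\<^sup>z\<^sup>-\<^sup>1 a) c * b d\<close> (\<open>L\<close> is self-adjoint for this form), and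
  the clique \<open>(m-2)! * \<Sum>\<^bsub>c \<noteq> d\<^esub> a c * b d * e\<^bsub>m-2\<^esub>(C - {c, d})\<close>.

  The remaining identity is one between power series in \<open>t\<close>. Put \<open>u c = 1 / (1 + t x c)\<close>,
  \<open>E = \<Prod>(1 + t x c)\<close>, \<open>Q = \<Sum>x c * u c = E' / E\<close>, \<open>V = 1 / (1 - t Q)\<close>, \<open>A = \<Sum>u c * a c\<close>,
  \<open>B = \<Sum>u c * b c\<close> and \<open>W = \<Sum>u c * a c * b c\<close>. The three generating functions are \<open>V A\<close> (and
  \<open>V B\<close>), \<open>t (V A B - W)\<close> and \<open>E (A B - (t W)')\<close>, and the claim becomes
  \<open>E (A B - (t W)') = E (t (V A B - W))' - t (E V A B)'\<close>.
\<close>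

section \<open>The identity for vectors indexed by colours\<close>

unbundle fps_syntax

definition esym :: "'c set \<Rightarrow> ('c \<Rightarrow> 'r::comm_ring_1) \<Rightarrow> nat \<Rightarrow> 'r" where
  "esym C x n = (\<Sum>S | S \<subseteq> C \<and> card S = n. \<Prod>c\<in>S. x c)"

definition walk_step :: "'c set \<Rightarrow> ('c \<Rightarrow> 'r::comm_ring_1) \<Rightarrow> ('c \<Rightarrow> 'r) \<Rightarrow> 'c \<Rightarrow> 'r" where
  "walk_step C x a = (\<lambda>c. x c * (sum a C - a c))"

text \<open>For finite \<open>C\<close> this is the sum of \<open>a c * b d\<close> over ordered
  pairs of distinct colours, that is, the effect of an edge between two roots.\<close>

definition off_diag :: "'c set \<Rightarrow> ('c \<Rightarrow> 'r::comm_ring_1) \<Rightarrow> ('c \<Rightarrow> 'r) \<Rightarrow> 'r" where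
  "off_diag C a b = sum a C * sum b C - (\<Sum>c\<in>C. a c * b c)"

text \<open>Both sides expand to the sum of \<open>x c * (sum a C - a c) * (sum b C - b c)\<close>,
  symmetric in \<open>a\<close> and \<open>b\<close>. Thus an edge can be moved from one end of a
  joining path to the other.\<close>

lemma off_diag_walk_step:
  "off_diag C (walk_step C x a) b = off_diag C a (walk_step C x b)"
proof -
  have "off_diag C (walk_step C x a) b = (\<Sum>c\<in>C. x c * ((sum a C - a c) * (sum b C - b c)))" for a b
    unfolding off_diag_def walk_step_def sum_distrib_right sum_subtractf[symmetric]
    by (simp add: algebra_simps)
  from this[of a b] this[of b a] show ?thesis
    by (simp add: off_diag_def mult.commute)
qed

lemma off_diag_walk_step_pow:
  "off_diag C ((walk_step C x ^^ k) a) b = off_diag C a ((walk_step C x ^^ k) b)"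
proof (induction k arbitrary: b)
  case (Suc k)
  then show ?case
    by (simp add: off_diag_walk_step flip: funpow_swap1)
qed simp

text \<open>Choosing one summand in each factor turns the product into a sum over subsets
  \<open>S\<close>, and \<open>S\<close> contributes in degree \<open>card S\<close> only.\<close>

lemma fps_nth_esym:
  assumes "finite C"
  shows "(\<Prod>c\<in>C. 1 + fps_const (x c) * fps_X) $ n = esym C x n"
proof -
  have const_prod: "(\<Prod>c\<in>S. fps_const (x c)) = fps_const (\<Prod>c\<in>S. x c)" for S
    by (induction S rule: infinite_finite_induct) auto
  have "(\<Prod>c\<in>C. fps_const (x c) * fps_X + 1)
      = (\<Sum>S\<in>Pow C. fps_const (\<Prod>c\<in>S. x c) * fps_X ^ card S)"
    by (simp add: prod_add[OF assms] prod.distrib const_prod)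
  then have "(\<Prod>c\<in>C. 1 + fps_const (x c) * fps_X) $ n
      = (\<Sum>S\<in>Pow C. if card S = n then \<Prod>c\<in>S. x c else 0)"
    by (auto simp: fps_sum_nth add.commute intro!: sum.cong)
  also have "\<dots> = esym C x n"
    unfolding esym_def using assms by (subst sum.inter_filter[symmetric]) (auto intro!: sum.cong)
  finally show ?thesis .
qed

text \<open>The coefficients form only a commutative ring, later a ring of polynomials, so inverses
  appear as witnesses obtained from the constant term 1.\<close>

lemma fps_unit_inverse:
  fixes f :: "'r::comm_ring_1 fps"
  assumes "f $ 0 = 1"
  obtains g where "f * g = 1"
  using fps_right_inverse[of f 1] assms by auto

text \<open>Logarithmic derivative of a product, with \<open>u c\<close> standing for
  \<open>1 / p c\<close>.\<close>

lemma fps_deriv_prod_unit: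
  fixes p u :: "'c \<Rightarrow> 'r::comm_ring_1 fps"
  assumes "finite C" and "\<And>c. p c * u c = 1"
  shows "fps_deriv (\<Prod>c\<in>C. p c) = (\<Prod>c\<in>C. p c) * (\<Sum>c\<in>C. fps_deriv (p c) * u c)"
  using assms(1)
proof (induction C rule: finite_induct)
  case (insert d C)
  have "fps_deriv (p d) * (\<Prod>c\<in>C. p c) = (p d * u d) * fps_deriv (p d) * (\<Prod>c\<in>C. p c)"
    by (simp add: assms(2))
  then show ?case using insert by (simp add: algebra_simps)
qed simp

text \<open>This is the coefficient of \<open>t^n\<close> in an identity of power series. The factor
  \<open>z\<close> comes from a derivative, \<open>i - 1\<close> from \<open>t E' - E\<close>, and
  the outer \<open>n\<close> from the operator \<open>t d/dt\<close>.\<close>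

lemma clique_identity:
  fixes x :: "'c \<Rightarrow> 'r::comm_ring_1"
  assumes "finite C"
  shows "(\<Sum>c\<in>C. \<Sum>d\<in>C - {c}. a c * b d * esym (C - {c, d}) x n) =
    (\<Sum>z = 1..Suc n. of_nat z * (esym C x (Suc n - z) * off_diag C ((walk_step C x ^^ (z - 1)) a) b))
    + of_nat n * (\<Sum>(i, j, k) \<in> {(i, j, k). i + j + k = n}.
        (of_nat i - 1) * (esym C x i * sum ((walk_step C x ^^ j) a) C * sum ((walk_step C x ^^ k) b) C))"
proof -
  let ?L = "walk_step C x"
  define p where "p c = 1 + fps_const (x c) * fps_X" for c
  have "\<exists>g. p c * g = 1" for c
    by (rule fps_unit_inverse[of "p c"]) (auto simp: p_def)
  then obtain u where u: "p c * u c = 1" for c by metis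
  define E where "E = (\<Prod>c\<in>C. p c)"
  have E_nth: "E $ n = esym C x n" for n
    unfolding E_def p_def using assms by (rule fps_nth_esym)
  define Q where "Q = (\<Sum>c\<in>C. fps_const (x c) * u c)"
  have E': "fps_deriv E = E * Q"
    unfolding E_def Q_def fps_deriv_prod_unit[of C p u, OF assms u] by (simp add: p_def)
  obtain V where V: "(1 - fps_X * Q) * V = 1"
    by (rule fps_unit_inverse[of "1 - fps_X * Q"]) auto
  have u_alt: "1 - fps_X * fps_const (x c) * u c = u c" for c
    using u[of c] by (simp add: p_def algebra_simps)
  define \<Phi> where "\<Phi> a c = Abs_fps (\<lambda>k. (?L ^^ k) a c)" for a c
  have \<Phi>_sum: "(\<Sum>c\<in>C. \<Phi> a c) = Abs_fps (\<lambda>k. sum ((?L ^^ k) a) C)" for a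
    by (simp add: fps_eq_iff fps_sum_nth \<Phi>_def)
  \<comment> \<open>Shifting the index by one turns the definition of \<open>walk_step\<close> into
    a linear equation; moving the term \<open>x c * t * \<Phi> a c\<close> to the left produces
    \<open>p c\<close>.\<close>
  have \<Phi>_rec: "\<Phi> a c * p c = fps_const (a c) + fps_const (x c) * fps_X * (\<Sum>c\<in>C. \<Phi> a c)" for a c
  proof -
    have "\<Phi> a c = fps_const (a c) + fps_const (x c) * fps_X * ((\<Sum>c\<in>C. \<Phi> a c) - \<Phi> a c)"
    proof (rule fps_ext)
      fix n
      show "\<Phi> a c $ n = (fps_const (a c) + fps_const (x c) * fps_X * ((\<Sum>c\<in>C. \<Phi> a c) - \<Phi> a c)) $ n"
        by (cases n) (simp_all add: \<Phi>_def fps_sum_nth mult.assoc walk_step_def)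
    qed
    then show ?thesis unfolding p_def by (simp add: algebra_simps)
  qed
  define A where "A a = (\<Sum>c\<in>C. fps_const (a c) * u c)" for a
  have \<Phi>_eq: "\<Phi> a c = fps_const (a c) * u c + fps_const (x c) * u c * fps_X * (\<Sum>c\<in>C. \<Phi> a c)" for a c
  proof -
    have "\<Phi> a c = \<Phi> a c * (p c * u c)" by (simp add: u)
    also have "\<dots> = (\<Phi> a c * p c) * u c" by (simp add: mult.assoc)
    finally show ?thesis unfolding \<Phi>_rec by (simp add: algebra_simps)
  qed
  \<comment> \<open>Summing \<open>\<Phi>_eq\<close> over \<open>c\<close> leaves the single unknown
    \<open>S\<close> with \<open>S = A a + t Q S\<close>, which \<open>V\<close> solves.\<close>
  have \<Phi>_sum_eq: "(\<Sum>c\<in>C. \<Phi> a c) = V * A a" for a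
  proof -
    define S where "S = (\<Sum>c\<in>C. \<Phi> a c)"
    have "S = (\<Sum>c\<in>C. fps_const (a c) * u c + fps_const (x c) * u c * fps_X * S)"
      unfolding S_def using \<Phi>_eq by (intro sum.cong refl)
    then have "S = A a + Q * fps_X * S"
      by (simp add: sum.distrib A_def Q_def sum_distrib_right)
    then have "(1 - fps_X * Q) * S = A a" by (simp add: algebra_simps)
    then have "((1 - fps_X * Q) * V) * S = V * A a" by (metis mult.assoc mult.commute)
    then show ?thesis using V by (simp add: S_def)
  qed
  define W where "W = (\<Sum>c\<in>C. fps_const (a c * b c) * u c)"
  define W2 where "W2 = (\<Sum>c\<in>C. fps_const (a c * b c) * (u c * u c))"
  \<comment> \<open>The extra factor \<open>fps_X\<close> puts \<open>z - 1\<close> iterations into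
    degree \<open>z\<close>, so that differentiation later supplies the weight
    \<open>z\<close>.\<close>
  define M where "M = fps_X * Abs_fps (\<lambda>k. off_diag C ((?L ^^ k) a) b)"
  have M_eq: "M = fps_X * (V * A a * A b - W)"
  proof -
    have "Abs_fps (\<lambda>k. off_diag C ((?L ^^ k) a) b)
        = (\<Sum>c\<in>C. \<Phi> a c) * (\<Sum>c\<in>C. fps_const (b c)) - (\<Sum>c\<in>C. \<Phi> a c * fps_const (b c))"
    proof -
      have const_sum: "(\<Sum>c\<in>C. fps_const (b c)) = fps_const (sum b C)"
        by (simp add: fps_eq_iff fps_sum_nth)
      show ?thesis
        unfolding \<Phi>_sum const_sum
        by (simp add: fps_eq_iff fps_sum_nth \<Phi>_def off_diag_def)
    qed
    \<comment> \<open>Inserting \<open>\<Phi>_eq\<close> splits off \<open>W\<close>; the remaining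
      part merges with the product of sums, where \<open>1 - t * x c * u c = u c\<close> turns the
      sum over \<open>b\<close> into \<open>A b\<close>.\<close>
    also have "(\<Sum>c\<in>C. \<Phi> a c * fps_const (b c)) = W + V * A a * (\<Sum>c\<in>C. fps_const (b c) * (fps_X * fps_const (x c) * u c))"
      unfolding W_def sum_distrib_left sum.distrib[symmetric]
    proof (rule sum.cong[OF refl])
      fix c
      show "\<Phi> a c * fps_const (b c) = fps_const (a c * b c) * u c + V * A a * (fps_const (b c) * (fps_X * fps_const (x c) * u c))"
        by (subst \<Phi>_eq) (simp add: \<Phi>_sum_eq algebra_simps flip: fps_const_mult)
    qed
    also have "(\<Sum>c\<in>C. \<Phi> a c) * (\<Sum>c\<in>C. fps_const (b c)) -
        (W + V * A a * (\<Sum>c\<in>C. fps_const (b c) * (fps_X * fps_const (x c) * u c)))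
       = V * A a * (\<Sum>c\<in>C. fps_const (b c) * (1 - fps_X * fps_const (x c) * u c)) - W"
      by (simp add: \<Phi>_sum_eq algebra_simps sum_subtractf)
    finally show ?thesis unfolding M_def by (simp only: u_alt A_def)
  qed
  have deriv_W: "fps_deriv (fps_X * W) = W2"
  proof -
    \<comment> \<open>Differentiating \<open>p c * u c = 1\<close> gives
      \<open>u' = - x u^2\<close>, hence \<open>(t u)' = u (1 - t x u) = u^2\<close>.\<close>
    have "fps_deriv (fps_X * u c) = u c * u c" for c
    proof -
      have "fps_deriv (p c * u c) = 0" by (simp add: u)
      then have "p c * fps_deriv (u c) + fps_const (x c) * u c = 0"
        by (simp add: p_def algebra_simps)
      then have "u c * (p c * fps_deriv (u c) + fps_const (x c) * u c) = 0" by simp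
      then have "(p c * u c) * fps_deriv (u c) = - (fps_const (x c) * u c * u c)"
        by (simp add: algebra_simps eq_neg_iff_add_eq_0)
      then have "fps_deriv (u c) = - (fps_const (x c) * u c * u c)" by (simp add: u)
      then have "fps_deriv (fps_X * u c) = (1 - fps_X * fps_const (x c) * u c) * u c"
        by (simp add: algebra_simps)
      then show ?thesis by (simp only: u_alt)
    qed
    then have "fps_deriv (\<Sum>c\<in>C. fps_const (a c * b c) * (fps_X * u c)) = W2"
      by (simp add: fps_deriv_sum W2_def)
    then show ?thesis by (simp add: W_def sum_distrib_left algebra_simps)
  qed
  have E_remove: "(\<Prod>c\<in>C - {c, d}. p c) = E * (u c * u d)" if "c \<in> C" "d \<in> C" "c \<noteq> d" for c d
  proof -
    have "E = p c * (p d * (\<Prod>c\<in>C - {c} - {d}. p c))"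
      unfolding E_def using assms that by (simp add: prod.remove[of C c] prod.remove[of "C - {c}" d])
    moreover have "C - {c} - {d} = C - {c, d}" by auto
    ultimately have "E * (u c * u d) = (p c * u c) * (p d * u d) * (\<Prod>c\<in>C - {c, d}. p c)"
      by (simp add: algebra_simps)
    then show ?thesis by (simp add: u)
  qed
  \<comment> \<open>The sum over \<open>d \<noteq> c\<close> is the full double sum, which factors
    into \<open>A a * A b\<close>, minus its diagonal, which is \<open>W2\<close>.\<close>
  have lhs: "(\<Sum>c\<in>C. \<Sum>d\<in>C - {c}. a c * b d * esym (C - {c, d}) x n) = (E * (A a * A b - W2)) $ n"
  proof -
    have "(\<Sum>c\<in>C. \<Sum>d\<in>C - {c}. a c * b d * esym (C - {c, d}) x n)
        = (\<Sum>c\<in>C. \<Sum>d\<in>C - {c}. fps_const (a c * b d) * (E * (u c * u d))) $ n"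
      unfolding fps_sum_nth
    proof (intro sum.cong refl)
      fix c d assume "c \<in> C" "d \<in> C - {c}"
      then have "esym (C - {c, d}) x n = (E * (u c * u d)) $ n"
        using E_remove[of c d] fps_nth_esym[of "C - {c, d}" x n] assms by (auto simp: p_def)
      then show "a c * b d * esym (C - {c, d}) x n = (fps_const (a c * b d) * (E * (u c * u d))) $ n"
        by (simp del: fps_const_mult)
    qed
    also have "(\<Sum>c\<in>C. \<Sum>d\<in>C - {c}. fps_const (a c * b d) * (E * (u c * u d)))
        = (\<Sum>c\<in>C. (\<Sum>d\<in>C. fps_const (a c * b d) * (E * (u c * u d))) - fps_const (a c * b c) * (E * (u c * u c)))"
      using assms by (intro sum.cong refl) (simp add: sum_diff1)
    also have "\<dots> = E * (A a * A b - W2)"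
      unfolding sum_subtractf right_diff_distrib A_def W2_def sum_product
      unfolding sum_distrib_left fps_const_mult[symmetric]
      by (simp only: mult_ac)
    finally show ?thesis .
  qed
  have rhs1: "(\<Sum>z = 1..Suc n. of_nat z * (esym C x (Suc n - z) * off_diag C ((?L ^^ (z - 1)) a) b)) = (fps_deriv M * E) $ n"
  proof -
    have "(\<Sum>z = 1..Suc n. of_nat z * (esym C x (Suc n - z) * off_diag C ((?L ^^ (z - 1)) a) b))
       = (\<Sum>z = 0..n. of_nat (Suc z) * (esym C x (n - z) * off_diag C ((?L ^^ z) a) b))"
      unfolding One_nat_def sum.shift_bounds_cl_Suc_ivl by simp
    also have "\<dots> = (fps_deriv M * E) $ n"
      unfolding fps_mult_nth E_nth fps_deriv_nth by (intro sum.cong refl) (simp add: M_def mult_ac)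
    finally show ?thesis .
  qed
  have rhs2: "(\<Sum>(i, j, k) \<in> {(i, j, k). i + j + k = n}.
        (of_nat i - 1) * (esym C x i * sum ((?L ^^ j) a) C * sum ((?L ^^ k) b) C))
      = - (E * V * A a * A b) $ n"
  proof -
    have "(\<Sum>(i, j, k) \<in> {(i, j, k). i + j + k = n}.
        (of_nat i - 1) * (esym C x i * sum ((?L ^^ j) a) C * sum ((?L ^^ k) b) C))
      = (\<Sum>(r, k) \<in> (SIGMA r:{0..n}. {0..r}). 
          (fps_X * fps_deriv E - E) $ k * (\<Sum>c\<in>C. \<Phi> a c) $ (r - k) * (\<Sum>c\<in>C. \<Phi> b c) $ (n - r))"
      \<comment> \<open>The pair \<open>(i + j, i)\<close> indexes triples as two nested Cauchy
        products do; in degree \<open>i\<close> the coefficient of \<open>t E' - E\<close> is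
        \<open>i - 1\<close> times that of \<open>E\<close>.\<close>
      by (rule sum.reindex_bij_witness[where j = "\<lambda>(i,j,k). (i + j, i)" and i = "\<lambda>(r,k). (k, r - k, n - r)"])
        (auto simp: \<Phi>_sum E_nth algebra_simps gr0_conv_Suc)
    also have "\<dots> = ((fps_X * fps_deriv E - E) * (\<Sum>c\<in>C. \<Phi> a c) * (\<Sum>c\<in>C. \<Phi> b c)) $ n"
      by (simp only: fps_mult_nth[of _ "\<Sum>c\<in>C. \<Phi> b c"] fps_mult_nth[of _ "\<Sum>c\<in>C. \<Phi> a c"]
          sum_distrib_right) (simp add: sum.Sigma)
    \<comment> \<open>Since \<open>E' = E Q\<close>, the first factor is
      \<open>- (1 - t Q) E\<close>, which cancels one of the two factors \<open>V\<close>.\<close>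
    also have "(fps_X * fps_deriv E - E) * (\<Sum>c\<in>C. \<Phi> a c) * (\<Sum>c\<in>C. \<Phi> b c)
        = - (((1 - fps_X * Q) * V) * (E * V * A a * A b))"
      unfolding \<Phi>_sum_eq E' by (simp add: algebra_simps)
    finally show ?thesis by (simp add: V)
  qed
  \<comment> \<open>With \<open>Y = V A B\<close> the terms containing \<open>Y'\<close> cancel;
    what is left is \<open>E (1 - t Q) Y - E W2\<close>, and \<open>(1 - t Q) V = 1\<close>.\<close>
  have "E * (A a * A b - W2) = fps_deriv M * E - fps_X * fps_deriv (E * V * A a * A b)"
  proof -
    define Y where "Y = V * A a * A b"
    have "fps_X * fps_deriv (E * V * A a * A b) = fps_X * (E * Q * Y + E * fps_deriv Y)"
      by (simp add: Y_def E'[symmetric] mult.assoc add.commute)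
    moreover have "fps_deriv M = fps_X * fps_deriv Y + Y - W2"
      by (simp add: M_eq Y_def[symmetric] right_diff_distrib deriv_W del: fps_deriv_mult)
        (simp add: algebra_simps)
    ultimately have "fps_deriv M * E - fps_X * fps_deriv (E * V * A a * A b)
        = E * ((1 - fps_X * Q) * Y) - E * W2"
      by (simp only:) (simp add: algebra_simps)
    also have "(1 - fps_X * Q) * Y = ((1 - fps_X * Q) * V) * (A a * A b)"
      by (simp only: Y_def mult.assoc)
    finally show ?thesis by (simp add: V right_diff_distrib)
  qed
  \<comment> \<open>In degree \<open>n\<close> the series \<open>t F'\<close> has \<open>n\<close>
    times the coefficient of \<open>F\<close>; degree 0 is treated apart because of the
    shift.\<close>
  then have "(E * (A a * A b - W2)) $ n
      = (fps_deriv M * E) $ n - of_nat n * (E * V * A a * A b) $ n"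
    by (cases n) (simp_all del: fps_deriv_mult)
  then show ?thesis unfolding lhs rhs1 rhs2 by simp
qed

section \<open>Colourings of composite graphs\<close>

definition colorings :: "'v graph \<Rightarrow> nat set \<Rightarrow> ('v \<Rightarrow> nat) set" where
  "colorings G C = {\<kappa> \<in> fst G \<rightarrow>\<^sub>E C. proper_coloring G \<kappa>}"

text \<open>With \<open>x = var\<close> this becomes the chromatic symmetric polynomial in the
  variables of \<open>C\<close>.\<close>

definition col_sum :: "'v graph \<Rightarrow> nat set \<Rightarrow> (nat \<Rightarrow> 'r::comm_ring_1) \<Rightarrow> 'r" where
  "col_sum G C x = (\<Sum>\<kappa>\<in>colorings G C. \<Prod>v\<in>fst G. x (\<kappa> v))"

definition root_sum :: "'v graph \<Rightarrow> 'v \<Rightarrow> nat set \<Rightarrow> (nat \<Rightarrow> 'r::comm_ring_1) \<Rightarrow> nat \<Rightarrow> 'r" where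
  "root_sum G u C x c = (\<Sum>\<kappa> | \<kappa> \<in> colorings G C \<and> \<kappa> u = c. \<Prod>v\<in>fst G. x (\<kappa> v))"

lemma finite_colorings: "finite (fst G) \<Longrightarrow> finite C \<Longrightarrow> finite (colorings G C)"
  unfolding colorings_def by (rule finite_subset[of _ "fst G \<rightarrow>\<^sub>E C"]) (auto intro: finite_PiE)

text \<open>Colourings are grouped by the colour of the root; the free factor \<open>q\<close>
  carries what the rest of a larger graph contributes for that colour.\<close>

lemma sum_colorings_by_root:
  assumes "finite (fst G)" "finite C" "u \<in> fst G"
  shows "(\<Sum>\<kappa>\<in>colorings G C. (\<Prod>v\<in>fst G. x (\<kappa> v)) * q (\<kappa> u)) = (\<Sum>c\<in>C. root_sum G u C x c * q c)"
proof -
  have "(\<lambda>\<kappa>. \<kappa> u) ` colorings G C \<subseteq> C"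
    using assms(3) by (auto simp: colorings_def)
  from sum.group[OF finite_colorings[OF assms(1,2)] assms(2) this,
      of "\<lambda>\<kappa>. (\<Prod>v\<in>fst G. x (\<kappa> v)) * q (\<kappa> u)"]
  show ?thesis
    by (simp add: root_sum_def sum_distrib_right)
qed

lemma col_sum_eq_sum_root_sum:
  assumes "finite (fst G)" "finite C" "u \<in> fst G"
  shows "col_sum G C x = (\<Sum>c\<in>C. root_sum G u C x c)"
  using sum_colorings_by_root[OF assms, of x "\<lambda>_. 1"] by (simp add: col_sum_def)

lemma proper_coloring_gunion:
  "proper_coloring (gunion G H) \<kappa> \<longleftrightarrow> proper_coloring G \<kappa> \<and> proper_coloring H \<kappa>"
  by (auto simp: proper_coloring_def gunion_def)

lemma proper_coloring_cong:
  assumes "simple_graph G" "\<And>v. v \<in> fst G \<Longrightarrow> \<kappa> v = \<kappa>' v"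
  shows "proper_coloring G \<kappa> \<longleftrightarrow> proper_coloring G \<kappa>'"
proof -
  have "\<kappa> v = \<kappa>' v" if "e \<in> snd G" "v \<in> e" for e v
    using assms that unfolding simple_graph_def by blast
  then show ?thesis unfolding proper_coloring_def by metis
qed

section \<open>Two graphs joined through a clique\<close>

definition complete_graph :: "'v set \<Rightarrow> 'v graph" where
  "complete_graph U = (U, {{a, b} | a b. a \<in> U \<and> b \<in> U \<and> a \<noteq> b})"

lemma proper_coloring_complete_graph:
  "proper_coloring (complete_graph U) \<kappa> \<longleftrightarrow> inj_on \<kappa> U"
  unfolding proper_coloring_def complete_graph_def inj_on_def by (auto; blast)

text \<open>An injection on \<open>W\<close> is an image of size \<open>card W\<close> together with
  one of \<open>fact (card W)\<close> bijections onto it, and its weight depends on the image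
  only.\<close>

lemma sum_injections:
  assumes "finite W" "finite A"
  shows "(\<Sum>\<kappa> | \<kappa> \<in> W \<rightarrow>\<^sub>E A \<and> inj_on \<kappa> W. \<Prod>w\<in>W. x (\<kappa> w)) = of_nat (fact (card W)) * esym A x (card W)"
proof -
  let ?I = "{\<kappa> \<in> W \<rightarrow>\<^sub>E A. inj_on \<kappa> W}" and ?T = "{S. S \<subseteq> A \<and> card S = card W}"
  have fin: "finite ?I" "finite ?T"
    using assms by (auto intro: finite_subset[of _ "W \<rightarrow>\<^sub>E A"] finite_PiE)
  have img: "(\<lambda>\<kappa>. \<kappa> ` W) ` ?I \<subseteq> ?T"
    by (auto simp: card_image)
  have "(\<Sum>\<kappa>\<in>?I. \<Prod>w\<in>W. x (\<kappa> w)) = (\<Sum>\<kappa>\<in>?I. \<Prod>c\<in>\<kappa> ` W. x c)"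
    by (intro sum.cong refl) (auto simp: prod.reindex)
  also have "\<dots> = (\<Sum>S\<in>?T. \<Sum>\<kappa> | \<kappa> \<in> ?I \<and> \<kappa> ` W = S. \<Prod>c\<in>\<kappa> ` W. x c)"
    by (rule sum.group[OF fin img, symmetric])
  also have "\<dots> = (\<Sum>S\<in>?T. of_nat (fact (card W)) * (\<Prod>c\<in>S. x c))"
  proof (intro sum.cong refl)
    fix S assume S: "S \<in> ?T"
    then have "finite S" using assms finite_subset by blast
    then have "{\<kappa> \<in> ?I. \<kappa> ` W = S} = {\<kappa> \<in> W \<rightarrow>\<^sub>E S. inj_on \<kappa> W}"
    proof (intro Collect_cong iffI)
      fix \<kappa> assume \<kappa>: "\<kappa> \<in> W \<rightarrow>\<^sub>E S \<and> inj_on \<kappa> W"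
      then have "\<kappa> ` W = S"
        using S by (intro card_subset_eq[OF \<open>finite S\<close>]) (auto simp: card_image)
      then show "\<kappa> \<in> ?I \<and> \<kappa> ` W = S"
        using \<kappa> S by (auto simp: PiE_iff)
    qed (auto simp: PiE_iff)
    moreover have "card {\<kappa> \<in> W \<rightarrow>\<^sub>E S. inj_on \<kappa> W} = fact (card W)"
      using card_inj_on_subset_funcset[OF assms(1) \<open>finite S\<close> subset_refl] S
      by (simp add: fact_prod_rev atLeast0LessThan)
    ultimately have "(\<Sum>\<kappa> | \<kappa> \<in> ?I \<and> \<kappa> ` W = S. \<Prod>c\<in>S. x c) = of_nat (fact (card W)) * (\<Prod>c\<in>S. x c)"
      by simp
    then show "(\<Sum>\<kappa> | \<kappa> \<in> ?I \<and> \<kappa> ` W = S. \<Prod>c\<in>\<kappa> ` W. x c) = of_nat (fact (card W)) * (\<Prod>c\<in>S. x c)"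
      by (metis (mono_tags, lifting) mem_Collect_eq sum.cong)
  qed
  finally show ?thesis by (simp add: esym_def sum_distrib_left)
qed

text \<open>The three parts are coloured independently, except that the root colours differ and
  \<open>W\<close> takes distinct colours avoiding both. Empty \<open>W\<close> yields a single
  joining edge, \<open>card W = m - 2\<close> the clique of size \<open>m\<close>.\<close>

lemma col_sum_clique_join:
  fixes x :: "nat \<Rightarrow> 'r::comm_ring_1"
  assumes G: "simple_graph G" "u \<in> fst G" and H: "simple_graph H" "v \<in> fst H"
    and W: "finite W" and C: "finite C"
    and disj: "fst G \<inter> fst H = {}" "fst G \<inter> W = {}" "fst H \<inter> W = {}"
  shows "col_sum (gunion (gunion G H) (complete_graph (insert u (insert v W)))) C x =
    of_nat (fact (card W)) * (\<Sum>c\<in>C. \<Sum>d\<in>C - {c}.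
      root_sum G u C x c * root_sum H v C x d * esym (C - {c, d}) x (card W))"
proof -
  let ?K = "gunion (gunion G H) (complete_graph (insert u (insert v W)))"
  have fin: "finite (fst G)" "finite (fst H)" using G H by (auto simp: simple_graph_def)
  have V: "fst ?K = fst G \<union> fst H \<union> W"
    using G H by (auto simp: gunion_def complete_graph_def)
  \<comment> \<open>Triples of colourings of \<open>G\<close>, \<open>H\<close> and \<open>W\<close>
    compatible along the clique; \<open>glue\<close> assembles them and restriction takes them
    apart.\<close>
  define T where "T = (SIGMA \<kappa>1:colorings G C. SIGMA \<kappa>2:{\<kappa> \<in> colorings H C. \<kappa> v \<noteq> \<kappa>1 u}.
      {\<kappa> \<in> W \<rightarrow>\<^sub>E C - {\<kappa>1 u, \<kappa>2 v}. inj_on \<kappa> W})"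
  define glue where "glue = (\<lambda>(\<kappa>1, \<kappa>2, \<kappa>3) w.
    if w \<in> fst G then \<kappa>1 w else if w \<in> fst H then \<kappa>2 w else \<kappa>3 w :: nat)"
  \<comment> \<open>The total weight of \<open>W\<close> once the roots have colours
    \<open>c\<close> and \<open>d\<close>. The value 0 at \<open>d = c\<close> absorbs the condition
    on the roots, so that \<open>sum_colorings_by_root\<close> applies to all colourings of
    \<open>H\<close>.\<close>
  define q where "q c d = (if d \<noteq> c then of_nat (fact (card W)) * esym (C - {c, d}) x (card W) else 0)" for c d
  have vu: "u \<noteq> v" "u \<notin> W" "v \<notin> W" "u \<notin> fst H" "v \<notin> fst G" using G H disj by auto
  have "col_sum ?K C x = (\<Sum>(\<kappa>1, \<kappa>2, \<kappa>3)\<in>T.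
      (\<Prod>w\<in>fst G. x (\<kappa>1 w)) * (\<Prod>w\<in>fst H. x (\<kappa>2 w)) * (\<Prod>w\<in>W. x (\<kappa>3 w)))"
    unfolding col_sum_def
  proof (rule sum.reindex_bij_witness[where i = glue and
        j = "\<lambda>\<kappa>. (restrict \<kappa> (fst G), restrict \<kappa> (fst H), restrict \<kappa> W)"])
    fix \<kappa> assume "\<kappa> \<in> colorings ?K C"
    then have \<kappa>: "\<kappa> \<in> fst G \<union> fst H \<union> W \<rightarrow>\<^sub>E C" "proper_coloring G \<kappa>" "proper_coloring H \<kappa>"
      "inj_on \<kappa> (insert u (insert v W))"
      by (auto simp: colorings_def V proper_coloring_gunion proper_coloring_complete_graph)
    show "glue (restrict \<kappa> (fst G), restrict \<kappa> (fst H), restrict \<kappa> W) = \<kappa>"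
    proof
      \<comment> \<open>Outside all three vertex sets both sides are \<open>undefined\<close>, since
        colourings are extensional.\<close>
      fix w show "glue (restrict \<kappa> (fst G), restrict \<kappa> (fst H), restrict \<kappa> W) w = \<kappa> w"
        using PiE_arb[OF \<kappa>(1), of w] by (auto simp: glue_def)
    qed
    have "proper_coloring G (restrict \<kappa> (fst G))" "proper_coloring H (restrict \<kappa> (fst H))"
      using \<kappa> proper_coloring_cong[OF G(1), of \<kappa> "restrict \<kappa> (fst G)"]
        proper_coloring_cong[OF H(1), of \<kappa> "restrict \<kappa> (fst H)"] by auto
    then show "(restrict \<kappa> (fst G), restrict \<kappa> (fst H), restrict \<kappa> W) \<in> T"
      using \<kappa>(1,4) G H vu unfolding T_def colorings_def
      by (auto simp: PiE_iff inj_on_def)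
    have "(\<Prod>w\<in>fst ?K. x (\<kappa> w)) = (\<Prod>w\<in>fst G. x (\<kappa> w)) * (\<Prod>w\<in>fst H. x (\<kappa> w)) * (\<Prod>w\<in>W. x (\<kappa> w))"
      unfolding V using fin W disj by (simp add: prod.union_disjoint Int_Un_distrib2)
    then show "(case (restrict \<kappa> (fst G), restrict \<kappa> (fst H), restrict \<kappa> W) of (\<kappa>1, \<kappa>2, \<kappa>3) \<Rightarrow>
        (\<Prod>w\<in>fst G. x (\<kappa>1 w)) * (\<Prod>w\<in>fst H. x (\<kappa>2 w)) * (\<Prod>w\<in>W. x (\<kappa>3 w))) = (\<Prod>w\<in>fst ?K. x (\<kappa> w))"
      by simp
  next
    fix t assume "t \<in> T"
    obtain \<kappa>1 \<kappa>2 \<kappa>3 where t: "t = (\<kappa>1, \<kappa>2, \<kappa>3)" by (cases t) auto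
    have \<kappa>1: "\<kappa>1 \<in> fst G \<rightarrow>\<^sub>E C" "proper_coloring G \<kappa>1"
      and \<kappa>2: "\<kappa>2 \<in> fst H \<rightarrow>\<^sub>E C" "proper_coloring H \<kappa>2"
      and \<kappa>3: "\<kappa>3 \<in> W \<rightarrow>\<^sub>E C - {\<kappa>1 u, \<kappa>2 v}" "inj_on \<kappa>3 W" and ne: "\<kappa>2 v \<noteq> \<kappa>1 u"
      using \<open>t \<in> T\<close> by (auto simp: t T_def colorings_def)
    have glue_G: "glue t w = \<kappa>1 w" if "w \<in> fst G" for w using that by (simp add: glue_def t)
    have glue_H: "glue t w = \<kappa>2 w" if "w \<in> fst H" for w using that disj by (auto simp: glue_def t)
    have glue_W: "glue t w = \<kappa>3 w" if "w \<in> W" for w using that disj by (auto simp: glue_def t)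
    have "restrict (glue t) (fst G) = \<kappa>1" "restrict (glue t) (fst H) = \<kappa>2" "restrict (glue t) W = \<kappa>3"
      using glue_G glue_H glue_W \<kappa>1(1) \<kappa>2(1) \<kappa>3(1)
      by (simp_all cong: restrict_cong add: PiE_restrict)
    then show "(restrict (glue t) (fst G), restrict (glue t) (fst H), restrict (glue t) W) = t"
      by (simp add: t)
    have "inj_on (glue t) (insert u (insert v W))"
      using \<kappa>3 ne vu G(2) H(2) glue_W unfolding inj_on_def by (auto simp: glue_G glue_H PiE_iff)
    moreover have "glue t \<in> fst G \<union> fst H \<union> W \<rightarrow>\<^sub>E C"
      using \<kappa>1 \<kappa>2 \<kappa>3 by (auto simp: PiE_iff extensional_def glue_def t)
    ultimately show "glue t \<in> colorings ?K C"
      using \<kappa>1 \<kappa>2 proper_coloring_cong[OF G(1) glue_G] proper_coloring_cong[OF H(1) glue_H]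
      by (simp add: colorings_def V proper_coloring_gunion proper_coloring_complete_graph)
  qed
  also have "\<dots> = (\<Sum>\<kappa>1\<in>colorings G C. \<Sum>\<kappa>2 | \<kappa>2 \<in> colorings H C \<and> \<kappa>2 v \<noteq> \<kappa>1 u.
      \<Sum>\<kappa>3 | \<kappa>3 \<in> W \<rightarrow>\<^sub>E C - {\<kappa>1 u, \<kappa>2 v} \<and> inj_on \<kappa>3 W.
      (\<Prod>w\<in>fst G. x (\<kappa>1 w)) * (\<Prod>w\<in>fst H. x (\<kappa>2 w)) * (\<Prod>w\<in>W. x (\<kappa>3 w)))"
  proof -
    have f3: "finite {\<kappa> \<in> W \<rightarrow>\<^sub>E C - {c, d}. inj_on \<kappa> W}" for c d
      using W C by (auto intro: finite_subset[of _ "W \<rightarrow>\<^sub>E C - {c, d}"] finite_PiE)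
    show ?thesis
      unfolding T_def using finite_colorings[OF fin(1) C] finite_colorings[OF fin(2) C] f3
      by (subst sum.Sigma[symmetric]; (subst sum.Sigma[symmetric])?) auto
  qed
  also have "\<dots> = (\<Sum>\<kappa>1\<in>colorings G C. (\<Prod>w\<in>fst G. x (\<kappa>1 w)) *
      (\<Sum>\<kappa>2\<in>colorings H C. (\<Prod>w\<in>fst H. x (\<kappa>2 w)) *
        q (\<kappa>1 u) (\<kappa>2 v)))"
  proof (intro sum.cong refl)
    fix \<kappa>1
    have "(\<Sum>\<kappa>2 | \<kappa>2 \<in> colorings H C \<and> \<kappa>2 v \<noteq> \<kappa>1 u.
        (\<Prod>w\<in>fst H. x (\<kappa>2 w)) * (of_nat (fact (card W)) * esym (C - {\<kappa>1 u, \<kappa>2 v}) x (card W)))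
      = (\<Sum>\<kappa>2\<in>colorings H C. (\<Prod>w\<in>fst H. x (\<kappa>2 w)) *
        q (\<kappa>1 u) (\<kappa>2 v))"
      using finite_colorings[OF fin(2) C] by (subst sum.inter_filter) (auto simp: q_def intro!: sum.cong)
    then show "(\<Sum>\<kappa>2 | \<kappa>2 \<in> colorings H C \<and> \<kappa>2 v \<noteq> \<kappa>1 u.
      \<Sum>\<kappa>3 | \<kappa>3 \<in> W \<rightarrow>\<^sub>E C - {\<kappa>1 u, \<kappa>2 v} \<and> inj_on \<kappa>3 W.
      (\<Prod>w\<in>fst G. x (\<kappa>1 w)) * (\<Prod>w\<in>fst H. x (\<kappa>2 w)) * (\<Prod>w\<in>W. x (\<kappa>3 w)))
      = (\<Prod>w\<in>fst G. x (\<kappa>1 w)) *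
      (\<Sum>\<kappa>2\<in>colorings H C. (\<Prod>w\<in>fst H. x (\<kappa>2 w)) *
        q (\<kappa>1 u) (\<kappa>2 v))"
      using W C by (simp add: sum_injections mult.assoc flip: sum_distrib_left)
  qed
  also have "\<dots> = (\<Sum>c\<in>C. root_sum G u C x c * (\<Sum>d\<in>C. root_sum H v C x d *
      q c d))"
    unfolding sum_colorings_by_root[OF fin(2) C H(2), of x "q c" for c]
    by (rule sum_colorings_by_root[OF fin(1) C G(2)])
  also have "\<dots> = (\<Sum>c\<in>C. root_sum G u C x c * (\<Sum>d\<in>C - {c}. root_sum H v C x d *
      (of_nat (fact (card W)) * esym (C - {c, d}) x (card W))))"
    using C by (intro sum.cong refl arg_cong2[where f = "(*)"] sum.mono_neutral_cong_right) (auto simp: q_def)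
  finally show ?thesis
    by (simp add: sum_distrib_left mult_ac)
qed

text \<open>Once the leaf \<open>w\<close> has colour \<open>c\<close>, the rest is any proper
  colouring of \<open>G\<close> whose root colour is not \<open>c\<close>; these weigh the total
  minus the entry at \<open>c\<close>.\<close>

lemma root_sum_leaf:
  assumes G: "simple_graph G" "u \<in> fst G" and w: "w \<notin> fst G" and C: "finite C" "c \<in> C"
  shows "root_sum (insert w (fst G), insert {u, w} (snd G)) w C x c = walk_step C x (root_sum G u C x) c"
proof -
  let ?G = "(insert w (fst G), insert {u, w} (snd G))"
  have fin: "finite (fst G)" using G by (auto simp: simple_graph_def)
  have uw: "u \<noteq> w" using G w by auto
  have proper: "proper_coloring ?G \<kappa> \<longleftrightarrow> \<kappa> u \<noteq> \<kappa> w \<and> proper_coloring G \<kappa>" for \<kappa>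
    using uw by (auto simp: proper_coloring_def)
  have cong: "proper_coloring G (\<kappa>(w := d)) \<longleftrightarrow> proper_coloring G \<kappa>" for \<kappa> d
    by (rule proper_coloring_cong[OF G(1)]) (use w in auto)
  have "root_sum ?G w C x c = (\<Sum>\<kappa> | \<kappa> \<in> colorings G C \<and> \<kappa> u \<noteq> c. x c * (\<Prod>v\<in>fst G. x (\<kappa> v)))"
    unfolding root_sum_def
  \<comment> \<open>Deleting the leaf resets \<open>w\<close> to \<open>undefined\<close>, the value
    that extensional colourings of \<open>G\<close> have there.\<close>
  proof (rule sum.reindex_bij_witness[where i = "\<lambda>\<kappa>. \<kappa>(w := c)" and j = "\<lambda>\<kappa>. \<kappa>(w := undefined)"])
    fix \<kappa> assume "\<kappa> \<in> {\<kappa> \<in> colorings ?G C. \<kappa> w = c}"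
    then have \<kappa>: "\<kappa> \<in> insert w (fst G) \<rightarrow>\<^sub>E C" "\<kappa> w = c" "\<kappa> u \<noteq> c" "proper_coloring G \<kappa>"
      by (auto simp: colorings_def proper)
    show "(\<kappa>(w := undefined))(w := c) = \<kappa>" using \<kappa> by auto
    show "\<kappa>(w := undefined) \<in> {\<kappa> \<in> colorings G C. \<kappa> u \<noteq> c}"
      using \<kappa> w uw by (auto simp: colorings_def cong PiE_iff extensional_def)
    have "(\<Prod>v\<in>fst G. x ((\<kappa>(w := undefined)) v)) = (\<Prod>v\<in>fst G. x (\<kappa> v))"
      using w by (intro prod.cong) auto
    then show "x c * (\<Prod>v\<in>fst G. x ((\<kappa>(w := undefined)) v)) = (\<Prod>v\<in>fst ?G. x (\<kappa> v))"
      using fin w \<kappa> by simp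
  next
    fix \<kappa> assume "\<kappa> \<in> {\<kappa> \<in> colorings G C. \<kappa> u \<noteq> c}"
    then show "(\<kappa>(w := c))(w := undefined) = \<kappa>" "\<kappa>(w := c) \<in> {\<kappa> \<in> colorings ?G C. \<kappa> w = c}"
      using w uw C by (auto simp: colorings_def proper cong PiE_iff extensional_def fun_eq_iff)
  qed
  also have "\<dots> = x c * ((\<Sum>\<kappa>\<in>colorings G C. \<Prod>v\<in>fst G. x (\<kappa> v)) - root_sum G u C x c)"
  proof -
    have "(\<Sum>\<kappa>\<in>colorings G C. \<Prod>v\<in>fst G. x (\<kappa> v)) =
        (\<Sum>\<kappa> | \<kappa> \<in> colorings G C \<and> \<kappa> u \<noteq> c. \<Prod>v\<in>fst G. x (\<kappa> v)) + root_sum G u C x c"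
      unfolding root_sum_def using finite_colorings[OF fin C(1)]
      by (subst sum.union_disjoint[symmetric]) (auto intro!: sum.cong)
    then show ?thesis by (simp add: sum_distrib_left)
  qed
  finally show ?thesis
    using col_sum_eq_sum_root_sum[OF fin C(1) G(2), of x] by (simp add: walk_step_def col_sum_def)
qed

section \<open>Attaching paths and relabelling vertices\<close>

lemma path_graph_map:
  "path_graph (map p [0..<Suc k]) = (p ` {..k}, {{p i, p (Suc i)} | i. i < k})"
proof -
  have *: "map p [0..<Suc k] ! i = p i" if "i \<le> k" for i
    using that by (simp add: less_Suc_eq_le del: upt_Suc)
  have "{{map p [0..<Suc k] ! i, map p [0..<Suc k] ! Suc i} | i. Suc i < length (map p [0..<Suc k])}
      = {{p i, p (Suc i)} | i. i < k}"
    using * by (force simp del: upt_Suc)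
  moreover have "{0..<Suc k} = {..k}" by auto
  ultimately show ?thesis by (simp add: path_graph_def del: upt_Suc)
qed

text \<open>Induction on the length: every edge hangs a leaf on the previous end. The formula is
  confined to \<open>c \<in> C\<close> because off \<open>C\<close> the entries of
  \<open>root_sum\<close> vanish, while those of \<open>walk_step\<close> need not.\<close>

lemma path_attach:
  assumes G: "simple_graph G" "p 0 \<in> fst G" and inj: "inj_on p {..k}"
    and new: "\<And>i. 0 < i \<Longrightarrow> i \<le> k \<Longrightarrow> p i \<notin> fst G" and C: "finite C"
  defines "GP \<equiv> gunion G (path_graph (map p [0..<Suc k]))"
  shows "simple_graph GP \<and> (\<forall>c\<in>C. root_sum GP (p k) C x c = (walk_step C x ^^ k) (root_sum G (p 0) C x) c)"
  unfolding GP_def path_graph_map using inj new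
proof (induction k)
  case 0
  have "gunion G (p ` {..0}, {{p i, p (Suc i)} | i. i < 0}) = G"
    using G by (auto simp: gunion_def prod_eq_iff)
  then show ?case using G by simp
next
  case (Suc k)
  define Gk where "Gk = gunion G (p ` {..k}, {{p i, p (Suc i)} | i. i < k})"
  have "inj_on p {..k}" using Suc.prems(1) by (rule inj_on_subset) auto
  then have IH: "simple_graph Gk" "\<And>c. c \<in> C \<Longrightarrow> root_sum Gk (p k) C x c = (walk_step C x ^^ k) (root_sum G (p 0) C x) c"
    using Suc.IH Suc.prems(2) unfolding Gk_def by auto
  have eq: "gunion G (p ` {..Suc k}, {{p i, p (Suc i)} | i. i < Suc k})
      = (insert (p (Suc k)) (fst Gk), insert {p k, p (Suc k)} (snd Gk))"
    by (auto simp: Gk_def gunion_def atMost_Suc less_Suc_eq)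
  have new': "p (Suc k) \<notin> fst Gk"
    using Suc.prems inj_onD[OF Suc.prems(1), of "Suc k"] by (force simp: Gk_def gunion_def)
  have old: "p k \<in> fst Gk" by (simp add: Gk_def gunion_def)
  have "simple_graph (insert (p (Suc k)) (fst Gk), insert {p k, p (Suc k)} (snd Gk))"
    using IH(1) new' old by (auto simp: simple_graph_def card_insert_if)
  \<comment> \<open>At a colour in \<open>C\<close>, \<open>walk_step\<close> reads its argument on
    \<open>C\<close> only, so the restricted induction hypothesis suffices.\<close>
  moreover have "walk_step C x (root_sum Gk (p k) C x) c
      = (walk_step C x ^^ Suc k) (root_sum G (p 0) C x) c" if "c \<in> C" for c
    using that IH(2) by (simp add: walk_step_def)
  ultimately show ?case
    unfolding eq by (simp add: root_sum_leaf[OF IH(1) old new' C])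
qed

lemma simple_graph_gmap:
  assumes "simple_graph G" "inj_on f (fst G)"
  shows "simple_graph (gmap f G)"
proof -
  have "card (f ` e) = 2" "f ` e \<subseteq> f ` fst G" if "e \<in> snd G" for e
    using assms that card_image[OF inj_on_subset[OF assms(2), of e]]
    by (auto simp: simple_graph_def)
  then show ?thesis using assms by (auto simp: simple_graph_def gmap_def)
qed

text \<open>Composition with \<open>f\<close> matches the colourings; injectivity keeps the ends of
  an edge distinct and lets \<open>inv_into\<close> undo the composition.\<close>

lemma root_sum_gmap:
  assumes G: "simple_graph G" "u \<in> fst G" and f: "inj_on f (fst G)"
  shows "root_sum (gmap f G) (f u) C x = root_sum G u C x"
proof
  fix c
  have proper: "proper_coloring (gmap f G) \<kappa> \<longleftrightarrow> proper_coloring G (\<kappa> \<circ> f)" for \<kappa>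
  proof -
    have "f a \<noteq> f b \<longleftrightarrow> a \<noteq> b" if "e \<in> snd G" "a \<in> e" "b \<in> e" for e a b
      using f G(1) that unfolding simple_graph_def inj_on_def by blast
    then show ?thesis unfolding proper_coloring_def gmap_def by auto
  qed
  show "root_sum (gmap f G) (f u) C x c = root_sum G u C x c"
    unfolding root_sum_def
  proof (rule sum.reindex_bij_witness[where j = "\<lambda>\<kappa>. restrict (\<kappa> \<circ> f) (fst G)"
        and i = "\<lambda>\<kappa>. restrict (\<kappa> \<circ> inv_into (fst G) f) (f ` fst G)"])
    fix \<kappa> assume "\<kappa> \<in> {\<kappa> \<in> colorings (gmap f G) C. \<kappa> (f u) = c}"
    then have \<kappa>: "\<kappa> \<in> f ` fst G \<rightarrow>\<^sub>E C" "proper_coloring G (\<kappa> \<circ> f)" "\<kappa> (f u) = c"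
      by (simp_all add: colorings_def proper) (simp add: gmap_def)
    show "restrict (restrict (\<kappa> \<circ> f) (fst G) \<circ> inv_into (fst G) f) (f ` fst G) = \<kappa>"
    proof
      fix w show "restrict (restrict (\<kappa> \<circ> f) (fst G) \<circ> inv_into (fst G) f) (f ` fst G) w = \<kappa> w"
        using PiE_arb[OF \<kappa>(1), of w] f by auto
    qed
    have "proper_coloring G (restrict (\<kappa> \<circ> f) (fst G))"
      using \<kappa>(2) proper_coloring_cong[OF G(1), of "\<kappa> \<circ> f" "restrict (\<kappa> \<circ> f) (fst G)"] by simp
    then show "restrict (\<kappa> \<circ> f) (fst G) \<in> {\<kappa> \<in> colorings G C. \<kappa> u = c}"
      using \<kappa> G(2) by (auto simp: colorings_def)
    show "(\<Prod>v\<in>fst G. x (restrict (\<kappa> \<circ> f) (fst G) v)) = (\<Prod>v\<in>fst (gmap f G). x (\<kappa> v))"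
      using f by (simp add: gmap_def prod.reindex)
  next
    fix \<kappa> assume "\<kappa> \<in> {\<kappa> \<in> colorings G C. \<kappa> u = c}"
    then have \<kappa>: "\<kappa> \<in> fst G \<rightarrow>\<^sub>E C" "proper_coloring G \<kappa>" "\<kappa> u = c"
      by (simp_all add: colorings_def)
    let ?\<kappa> = "restrict (\<kappa> \<circ> inv_into (fst G) f) (f ` fst G)"
    have f\<kappa>: "?\<kappa> (f v) = \<kappa> v" if "v \<in> fst G" for v
      using f that by simp
    show "restrict (?\<kappa> \<circ> f) (fst G) = \<kappa>"
    proof
      fix w show "restrict (?\<kappa> \<circ> f) (fst G) w = \<kappa> w"
        using PiE_arb[OF \<kappa>(1), of w] f\<kappa> by (simp add: restrict_def)
    qed
    have "proper_coloring G (?\<kappa> \<circ> f)"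
      using \<kappa>(2) proper_coloring_cong[OF G(1), of "?\<kappa> \<circ> f" \<kappa>] f\<kappa> by simp
    moreover have "?\<kappa> \<in> f ` fst G \<rightarrow>\<^sub>E C"
      using \<kappa>(1) f\<kappa> by (force simp: PiE_iff)
    ultimately show "?\<kappa> \<in> {\<kappa> \<in> colorings (gmap f G) C. \<kappa> (f u) = c}"
      using \<kappa>(3) f\<kappa>[OF G(2)] by (simp add: colorings_def proper) (simp add: gmap_def)
  qed
qed

section \<open>Colour sums of the joined, pendant and clique graphs\<close>

lemma complete_graph_pair: "a \<noteq> b \<Longrightarrow> complete_graph {a, b} = ({a, b}, {{a, b}})"
  by (auto simp: complete_graph_def insert_commute)

lemma esym_0: "finite C \<Longrightarrow> esym C x 0 = 1"
proof -
  assume "finite C"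
  then have "{S. S \<subseteq> C \<and> card S = 0} = {{}}" by (auto dest: finite_subset)
  then show ?thesis by (simp add: esym_def)
qed

lemma root_sum_K1:
  assumes "c \<in> C"
  shows "root_sum K1 () C x c = x c"
proof -
  have "{\<kappa> \<in> colorings K1 C. \<kappa> () = c} = {\<lambda>_. c}"
    using assms by (auto simp: colorings_def K1_def proper_coloring_def fun_eq_iff)
  then show ?thesis by (simp add: root_sum_def K1_def)
qed

text \<open>All edges of the path but the last are hung on \<open>G\<close>; the last one is a
  clique join with empty \<open>W\<close>. Length 0 identifies the roots instead of joining them,
  hence \<open>Suc k\<close>.\<close>

lemma col_sum_Pk:
  assumes G: "simple_graph G" "u \<in> fst G" and H: "simple_graph H" "v \<in> fst H" and C: "finite C"
  shows "col_sum (Pk (Suc k) G u H v) C x =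
    off_diag C ((walk_step C x ^^ k) (root_sum G u C x)) (root_sum H v C x)"
proof -
  define eG :: "'a \<Rightarrow> ('a + 'b) + nat" where "eG a = Inl (Inl a)" for a
  define eH :: "'b \<Rightarrow> ('a + 'b) + nat" where "eH b = Inl (Inr b)" for b
  define p where "p i = (if i = 0 then eG u else if i = Suc k then eH v else Inr i)" for i
  have injs: "inj_on eG (fst G)" "inj_on eH (fst H)" by (auto simp: eG_def eH_def inj_on_def)
  \<comment> \<open>\<open>p\<close> runs on to \<open>eH v\<close> at \<open>Suc k\<close>, but
    only its first \<open>k\<close> edges enter \<open>GP\<close>.\<close>
  define GP where "GP = gunion (gmap eG G) (path_graph (map p [0..<Suc k]))"
  have "simple_graph GP \<and> (\<forall>c\<in>C. root_sum GP (p k) C x c = (walk_step C x ^^ k) (root_sum (gmap eG G) (p 0) C x) c)"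
    unfolding GP_def
  proof (rule path_attach)
    show "simple_graph (gmap eG G)" using G injs by (intro simple_graph_gmap)
    show "p 0 \<in> fst (gmap eG G)" using G by (simp add: p_def gmap_def)
    show "inj_on p {..k}" by (auto simp: inj_on_def p_def eG_def)
    show "p i \<notin> fst (gmap eG G)" if "0 < i" "i \<le> k" for i
      using that by (auto simp: p_def gmap_def eG_def)
  qed (rule C)
  moreover have "root_sum (gmap eG G) (p 0) C x = root_sum G u C x"
    using root_sum_gmap[OF G injs(1)] by (simp add: p_def)
  ultimately have GP: "simple_graph GP"
    "\<And>c. c \<in> C \<Longrightarrow> root_sum GP (p k) C x c = (walk_step C x ^^ k) (root_sum G u C x) c"
    by auto
  have ne: "p k \<noteq> eH v" by (auto simp: p_def eG_def eH_def)
  have "Pk (Suc k) G u H v = gunion (gunion (gmap eG G) (gmap eH H)) (path_graph (map p [0..<Suc (Suc k)]))"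
    unfolding Pk_def Let_def p_def eG_def[abs_def] eH_def[abs_def] by simp
  also have "\<dots> = gunion (gunion GP (gmap eH H)) (complete_graph (insert (p k) (insert (eH v) {})))"
  proof -
    have "eH v \<in> fst (gmap eH H)" using H by (simp add: gmap_def)
    moreover have "p (Suc k) = eH v" by (simp add: p_def)
    ultimately show ?thesis
      unfolding complete_graph_pair[OF ne] GP_def path_graph_map gunion_def
      by (auto simp: atMost_Suc less_Suc_eq)
  qed
  finally have eq: "Pk (Suc k) G u H v = \<dots>" .
  have "col_sum (Pk (Suc k) G u H v) C x = of_nat (fact (card ({} :: (('a + 'b) + nat) set))) *
     (\<Sum>c\<in>C. \<Sum>d\<in>C - {c}. root_sum GP (p k) C x c * root_sum (gmap eH H) (eH v) C x d *
        esym (C - {c, d}) x (card ({} :: (('a + 'b) + nat) set)))"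
    unfolding eq
  proof (rule col_sum_clique_join[OF GP(1)])
    show "p k \<in> fst GP" by (auto simp: GP_def gunion_def path_graph_map simp del: upt_Suc)
    show "simple_graph (gmap eH H)" using H injs by (intro simple_graph_gmap)
    show "eH v \<in> fst (gmap eH H)" using H by (simp add: gmap_def)
    show "fst GP \<inter> fst (gmap eH H) = {}"
      by (auto simp: GP_def gunion_def path_graph_map gmap_def p_def eG_def eH_def simp del: upt_Suc)
  qed (use C in auto)
  also have "\<dots> = (\<Sum>c\<in>C. \<Sum>d\<in>C - {c}. (walk_step C x ^^ k) (root_sum G u C x) c * root_sum H v C x d)"
    using C GP(2) root_sum_gmap[OF H injs(2), of C x] by (simp add: esym_0)
  also have "\<dots> = off_diag C ((walk_step C x ^^ k) (root_sum G u C x)) (root_sum H v C x)"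
    using C by (simp add: off_diag_def sum_diff1 right_diff_distrib sum_subtractf sum_distrib_right
        flip: sum_distrib_left)
  finally show ?thesis .
qed

text \<open>Length 0 gives a copy of \<open>G\<close>. Otherwise the far end is \<open>K1\<close>,
  whose root vector is \<open>x\<close> on \<open>C\<close>, and pairing with \<open>x\<close> under
  \<open>off_diag\<close> is one more \<open>walk_step\<close> followed by summation.\<close>

lemma col_sum_pendant:
  assumes G: "simple_graph G" "u \<in> fst G" and C: "finite C"
  shows "col_sum (pendant k G u) C x = sum ((walk_step C x ^^ k) (root_sum G u C x)) C"
proof (cases k)
  case 0
  define e :: "'a \<Rightarrow> ('a + unit) + nat" where "e a = Inl (Inl a)" for a
  have inj: "inj_on e (fst G)" by (auto simp: e_def inj_on_def)
  have "pendant 0 G u = gmap e G"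
    using G by (auto simp: pendant_def Pk_def Let_def gunion_def gmap_def K1_def path_graph_def e_def)
  moreover have "finite (fst (gmap e G))" "e u \<in> fst (gmap e G)"
    using G by (auto simp: gmap_def simple_graph_def)
  ultimately show ?thesis
    using root_sum_gmap[OF G inj, of C x] col_sum_eq_sum_root_sum[of "gmap e G" C "e u" x] C 0 by simp
next
  case (Suc j)
  let ?a = "(walk_step C x ^^ j) (root_sum G u C x)"
  have "simple_graph K1" "() \<in> fst K1" by (auto simp: simple_graph_def K1_def)
  then have "col_sum (pendant k G u) C x = off_diag C ?a (root_sum K1 () C x)"
    unfolding pendant_def Suc by (intro col_sum_Pk G C)
  also have "\<dots> = (\<Sum>c\<in>C. x c * (sum ?a C - ?a c))"
    unfolding right_diff_distrib sum_subtractf sum_distrib_right[symmetric]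
    by (simp add: off_diag_def root_sum_K1 mult.commute)
  finally show ?thesis by (simp add: Suc walk_step_def)
qed

text \<open>\<open>Kmgh\<close> lists its second path from the clique towards \<open>H\<close>,
  whereas \<open>path_attach\<close> grows a path away from the root.\<close>

lemma path_graph_rev: "path_graph (map p [0..<Suc h]) = path_graph (map (\<lambda>i. p (h - i)) [0..<Suc h])"
proof -
  have "p ` {..h} = (\<lambda>i. p (h - i)) ` {..h}"
  proof -
    have "(\<lambda>i. h - i) ` {..h} = {..h}"
      by (rule bij_betw_imp_surj_on, rule bij_betwI[where g = "\<lambda>i. h - i"]) auto
    then show ?thesis by (metis image_image)
  qed
  moreover have "{{p i, p (Suc i)} | i. i < h} = {{p (h - i), p (h - Suc i)} | i. i < h}"
  proof (intro equalityI subsetI)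
    fix e assume "e \<in> {{p i, p (Suc i)} | i. i < h}"
    then obtain i where "e = {p i, p (Suc i)}" "i < h" by auto
    then have "e = {p (h - (h - Suc i)), p (h - Suc (h - Suc i))}" "h - Suc i < h"
      by (auto simp: Suc_diff_Suc insert_commute)
    then show "e \<in> {{p (h - i), p (h - Suc i)} | i. i < h}" by blast
  next
    fix e assume "e \<in> {{p (h - i), p (h - Suc i)} | i. i < h}"
    then obtain i where "e = {p (h - i), p (h - Suc i)}" "i < h" by auto
    then have "e = {p (h - Suc i), p (Suc (h - Suc i))}" "h - Suc i < h"
      by (auto simp: Suc_diff_Suc insert_commute)
    then show "e \<in> {{p i, p (Suc i)} | i. i < h}" by blast
  qed
  ultimately show ?thesis unfolding path_graph_map by simp
qed

text \<open>Each arm is hung on its own graph; the two new ends are the vertices 0 and 1 of the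
  clique, and the other \<open>m - 2\<close> clique vertices form \<open>W\<close>.\<close>

lemma col_sum_Kmgh:
  assumes G: "simple_graph G" "u \<in> fst G" and H: "simple_graph H" "v \<in> fst H" and C: "finite C"
    and m: "m \<ge> 2"
  shows "col_sum (Kmgh m g h G u H v) C x = of_nat (fact (m - 2)) *
    (\<Sum>c\<in>C. \<Sum>d\<in>C - {c}. (walk_step C x ^^ g) (root_sum G u C x) c *
      (walk_step C x ^^ h) (root_sum H v C x) d * esym (C - {c, d}) x (m - 2))"
proof -
  define eG :: "'a \<Rightarrow> ('a + 'b) + (nat + (nat + nat))" where "eG a = Inl (Inl a)" for a
  define eH :: "'b \<Rightarrow> ('a + 'b) + (nat + (nat + nat))" where "eH b = Inl (Inr b)" for b
  define eK where "eK j = (if j = 0 \<and> g = 0 then eG u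
                   else if j = 1 \<and> h = 0 then eH v else Inr (Inl j))" for j
  define p where "p i = (if i = 0 then eG u else if i = g then eK 0 else Inr (Inr (Inl i)))" for i
  define r where "r i = (if i = 0 then eK 1 else if i = h then eH v else Inr (Inr (Inr i)))" for i
  define q where "q i = r (h - i)" for i
  define W where "W = eK ` {2..<m}"
  have injs: "inj_on eG (fst G)" "inj_on eH (fst H)" by (auto simp: eG_def eH_def inj_on_def)
  \<comment> \<open>The identifications for \<open>g = 0\<close> and \<open>h = 0\<close> land in
    copies of different graphs, so they never merge two clique vertices.\<close>
  have eK_inj: "eK i = eK j \<longleftrightarrow> i = j" for i j by (auto simp: eK_def eG_def eH_def)
  define GP where "GP = gunion (gmap eG G) (path_graph (map p [0..<Suc g]))"
  define HP where "HP = gunion (gmap eH H) (path_graph (map q [0..<Suc h]))"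
  have "simple_graph GP \<and> (\<forall>c\<in>C. root_sum GP (p g) C x c = (walk_step C x ^^ g) (root_sum (gmap eG G) (p 0) C x) c)"
    unfolding GP_def
  proof (rule path_attach)
    show "simple_graph (gmap eG G)" using G injs by (intro simple_graph_gmap)
    show "p 0 \<in> fst (gmap eG G)" using G by (simp add: p_def gmap_def)
    show "inj_on p {..g}" by (auto simp: inj_on_def p_def eG_def eK_def split: if_splits)
    show "p i \<notin> fst (gmap eG G)" if "0 < i" "i \<le> g" for i
      using that by (auto simp: p_def gmap_def eG_def eK_def)
  qed (rule C)
  moreover have "root_sum (gmap eG G) (p 0) C x = root_sum G u C x"
    using root_sum_gmap[OF G injs(1)] by (simp add: p_def)
  moreover have pg: "p g = eK 0" by (simp add: p_def eK_def)
  ultimately have GP: "simple_graph GP"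
    "\<And>c. c \<in> C \<Longrightarrow> root_sum GP (eK 0) C x c = (walk_step C x ^^ g) (root_sum G u C x) c"
    by auto
  \<comment> \<open>For \<open>h = 0\<close> the path has the single vertex \<open>eK 1\<close>,
    which by identification is \<open>eH v\<close>.\<close>
  have q0: "q 0 = eH v" by (simp add: q_def r_def eK_def)
  have "simple_graph HP \<and> (\<forall>c\<in>C. root_sum HP (q h) C x c = (walk_step C x ^^ h) (root_sum (gmap eH H) (q 0) C x) c)"
    unfolding HP_def
  proof (rule path_attach)
    show "simple_graph (gmap eH H)" using H injs by (intro simple_graph_gmap)
    show "q 0 \<in> fst (gmap eH H)" using H by (simp add: q0 gmap_def)
    show "inj_on q {..h}" by (auto simp: inj_on_def q_def r_def eH_def eK_def split: if_splits)
    show "q i \<notin> fst (gmap eH H)" if "0 < i" "i \<le> h" for i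
      using that by (auto simp: q_def r_def gmap_def eH_def eK_def)
  qed (rule C)
  moreover have "root_sum (gmap eH H) (q 0) C x = root_sum H v C x"
    using root_sum_gmap[OF H injs(2)] by (simp add: q0)
  moreover have qh: "q h = eK 1" by (simp add: q_def r_def)
  ultimately have HP: "simple_graph HP"
    "\<And>c. c \<in> C \<Longrightarrow> root_sum HP (eK 1) C x c = (walk_step C x ^^ h) (root_sum H v C x) c"
    by auto
  have roots: "eK 0 \<in> fst GP" "eK 1 \<in> fst HP"
    unfolding pg[symmetric] qh[symmetric] GP_def HP_def gunion_def path_graph_map by auto
  \<comment> \<open>Indices from 2 on are untouched by the identifications, which makes
    \<open>W\<close> disjoint from both arms.\<close>
  have W_eq: "W = (\<lambda>j. Inr (Inl j)) ` {2..<m}"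
    unfolding W_def by (intro image_cong refl) (auto simp: eK_def)
  have card_W: "card W = m - 2" unfolding W_eq by (subst card_image) (auto simp: inj_on_def)
  have "eK ` {0..<m} = insert (eK 0) (insert (eK 1) W)"
  proof -
    have "{0..<m} = insert 0 (insert 1 {2..<m})" using m by auto
    then show ?thesis by (simp add: W_def)
  qed
  moreover have "{{eK i, eK j} | i j. i < m \<and> j < m \<and> i \<noteq> j}
      = {{a, b} | a b. a \<in> eK ` {0..<m} \<and> b \<in> eK ` {0..<m} \<and> a \<noteq> b}"
    by (fastforce simp: eK_inj)
  ultimately have Km: "(eK ` {0..<m}, {{eK i, eK j} | i j. i < m \<and> j < m \<and> i \<noteq> j})
      = complete_graph (insert (eK 0) (insert (eK 1) W))"
    by (simp add: complete_graph_def)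
  have "Kmgh m g h G u H v = gunion (gunion (gunion (gmap eG G) (gmap eH H))
      (eK ` {0..<m}, {{eK i, eK j} | i j. i < m \<and> j < m \<and> i \<noteq> j}))
      (gunion (path_graph (map p [0..<Suc g])) (path_graph (map r [0..<Suc h])))"
    unfolding Kmgh_def Let_def p_def[abs_def] r_def[abs_def] eK_def[abs_def] eG_def[abs_def] eH_def[abs_def]
    by (rule refl)
  also have "path_graph (map r [0..<Suc h]) = path_graph (map q [0..<Suc h])"
    unfolding q_def by (rule path_graph_rev)
  also have "gunion (gunion (gunion (gmap eG G) (gmap eH H))
      (eK ` {0..<m}, {{eK i, eK j} | i j. i < m \<and> j < m \<and> i \<noteq> j}))
      (gunion (path_graph (map p [0..<Suc g])) (path_graph (map q [0..<Suc h])))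
    = gunion (gunion GP HP) (complete_graph (insert (eK 0) (insert (eK 1) W)))"
    unfolding Km GP_def HP_def gunion_def by (simp add: Un_ac)
  finally have eq: "Kmgh m g h G u H v = \<dots>" .
  have "col_sum (Kmgh m g h G u H v) C x = of_nat (fact (card W)) *
     (\<Sum>c\<in>C. \<Sum>d\<in>C - {c}. root_sum GP (eK 0) C x c * root_sum HP (eK 1) C x d *
        esym (C - {c, d}) x (card W))"
    unfolding eq
  proof (rule col_sum_clique_join[OF GP(1) roots(1) HP(1) roots(2) _ C])
    show "finite W" by (simp add: W_def)
    show "fst GP \<inter> fst HP = {}" "fst GP \<inter> W = {}" "fst HP \<inter> W = {}"
      by (auto simp: GP_def HP_def W_eq gunion_def path_graph_map gmap_def p_def q_def r_def eK_def
          eG_def eH_def simp del: upt_Suc split: if_splits)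
  qed
  then show ?thesis by (simp add: card_W GP(2) HP(2) del: One_nat_def)
qed

section \<open>Coefficients of chromatic symmetric functions\<close>

text \<open>The variable \<open>x_i\<close> as a polynomial: the inner mapping is an exponent
  vector, the outer one attaches coefficients to exponent vectors.\<close>

definition var :: "nat \<Rightarrow> (nat \<Rightarrow>\<^sub>0 nat) \<Rightarrow>\<^sub>0 rat" where
  "var i = Poly_Mapping.single (Poly_Mapping.single i 1) 1"

lemma prod_var:
  "(\<Prod>v\<in>V. var (\<kappa> v)) = Poly_Mapping.single (\<Sum>v\<in>V. Poly_Mapping.single (\<kappa> v) 1) 1"
proof (induction V rule: infinite_finite_induct)
  case (insert v V)
  then show ?case by (simp add: var_def mult_single)
qed simp_all

lemma lookup_sum_single:
  "finite V \<Longrightarrow> Poly_Mapping.lookup (\<Sum>v\<in>V. Poly_Mapping.single (\<kappa> v) (1::nat)) i = card {v \<in> V. \<kappa> v = i}"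
  by (simp add: lookup_sum lookup_single when_def sum.If_cases Int_def)

text \<open>Equality after setting all variables outside \<open>C\<close> to 0; it allows a series
  in infinitely many variables to be replaced by a polynomial.\<close>

definition agrees :: "nat set \<Rightarrow> ((nat \<Rightarrow>\<^sub>0 nat) \<Rightarrow>\<^sub>0 rat) \<Rightarrow> sf \<Rightarrow> bool" where
  "agrees C P f \<longleftrightarrow> (\<forall>\<alpha>. Poly_Mapping.keys \<alpha> \<subseteq> C \<longrightarrow> Poly_Mapping.lookup P \<alpha> = f \<alpha>)"

text \<open>A colouring that contributes to a monomial uses only colours occurring in it, so
  restricting the colours to \<open>C\<close> loses nothing.\<close>

lemma agrees_csf:
  assumes "finite (fst G)" "finite C"
  shows "agrees C (col_sum G C var) (csf G)"
  unfolding agrees_def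
proof (intro allI impI)
  fix \<alpha> :: "nat \<Rightarrow>\<^sub>0 nat" assume \<alpha>: "Poly_Mapping.keys \<alpha> \<subseteq> C"
  let ?e = "\<lambda>\<kappa>. \<Sum>v\<in>fst G. Poly_Mapping.single (\<kappa> v) (1::nat)"
  have e: "?e \<kappa> = \<alpha> \<longleftrightarrow> (\<forall>i. card {v \<in> fst G. \<kappa> v = i} = Poly_Mapping.lookup \<alpha> i)" for \<kappa>
    unfolding poly_mapping_eq_iff fun_eq_iff lookup_sum_single[OF assms(1)] by (rule refl)
  have "\<kappa> v \<in> C" if "\<forall>i. card {v \<in> fst G. \<kappa> v = i} = Poly_Mapping.lookup \<alpha> i" "v \<in> fst G" for \<kappa> v
  proof -
    have "card {w \<in> fst G. \<kappa> w = \<kappa> v} \<noteq> 0" using that(2) assms(1) by (auto simp: card_eq_0_iff)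
    then have "Poly_Mapping.lookup \<alpha> (\<kappa> v) \<noteq> 0" using that(1) by simp
    then have "\<kappa> v \<in> Poly_Mapping.keys \<alpha>" by (simp add: in_keys_iff)
    then show ?thesis using \<alpha> by blast
  qed
  then have *: "{\<kappa> \<in> fst G \<rightarrow>\<^sub>E (UNIV :: nat set).
       proper_coloring G \<kappa> \<and> (\<forall>i. card {v \<in> fst G. \<kappa> v = i} = Poly_Mapping.lookup \<alpha> i)}
      = {\<kappa> \<in> colorings G C. ?e \<kappa> = \<alpha>}"
    unfolding e colorings_def by (auto simp: PiE_iff)
  have "Poly_Mapping.lookup (col_sum G C var) \<alpha> = (\<Sum>\<kappa>\<in>colorings G C. if ?e \<kappa> = \<alpha> then 1 else 0)"
    by (simp add: col_sum_def prod_var lookup_sum lookup_single when_def)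
  also have "\<dots> = of_nat (card {\<kappa> \<in> colorings G C. ?e \<kappa> = \<alpha>})"
    using finite_colorings[OF assms] by (simp add: sum.If_cases Int_def)
  finally show "Poly_Mapping.lookup (col_sum G C var) \<alpha> = csf G \<alpha>"
    by (simp add: csf_def *)
qed

text \<open>A subset \<open>S\<close> has a squarefree exponent vector with support
  \<open>S\<close>, so only the support of \<open>\<alpha>\<close> can contribute.\<close>

lemma agrees_elem:
  assumes "finite C"
  shows "agrees C (esym C var n) (elem n)"
  unfolding agrees_def
proof (intro allI impI)
  fix \<alpha> :: "nat \<Rightarrow>\<^sub>0 nat" assume \<alpha>: "Poly_Mapping.keys \<alpha> \<subseteq> C"
  let ?T = "{S. S \<subseteq> C \<and> card S = n}"
  let ?e = "\<lambda>S. \<Sum>v\<in>S. Poly_Mapping.single v (1::nat)"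
  have e: "?e S = \<alpha> \<longleftrightarrow> (\<forall>i. Poly_Mapping.lookup \<alpha> i \<le> 1) \<and> S = Poly_Mapping.keys \<alpha>" if "S \<in> ?T" for S
  proof -
    have "finite S" using that assms finite_subset by blast
    have "Poly_Mapping.lookup (?e S) i = (if i \<in> S then 1 else 0)" for i
    proof -
      have "{v \<in> S. v = i} = (if i \<in> S then {i} else {})" by auto
      then show ?thesis using lookup_sum_single[OF \<open>finite S\<close>, of "\<lambda>v. v" i] by simp
    qed
    then have "?e S = \<alpha> \<longleftrightarrow> (\<forall>i. Poly_Mapping.lookup \<alpha> i = (if i \<in> S then 1 else 0))"
      by (auto simp: poly_mapping_eq_iff fun_eq_iff)
    also have "\<dots> \<longleftrightarrow> (\<forall>i. Poly_Mapping.lookup \<alpha> i \<le> 1) \<and> S = Poly_Mapping.keys \<alpha>"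
    proof
      assume *: "\<forall>i. Poly_Mapping.lookup \<alpha> i = (if i \<in> S then 1 else 0)"
      then show "(\<forall>i. Poly_Mapping.lookup \<alpha> i \<le> 1) \<and> S = Poly_Mapping.keys \<alpha>"
        by (auto simp: in_keys_iff split: if_splits)
    next
      assume *: "(\<forall>i. Poly_Mapping.lookup \<alpha> i \<le> 1) \<and> S = Poly_Mapping.keys \<alpha>"
      then show "\<forall>i. Poly_Mapping.lookup \<alpha> i = (if i \<in> S then 1 else 0)"
        by (metis in_keys_iff le_neq_implies_less less_one)
    qed
    finally show ?thesis .
  qed
  have "Poly_Mapping.lookup (esym C var n) \<alpha> = (\<Sum>S\<in>?T. if ?e S = \<alpha> then 1 else 0)"
    using prod_var[where \<kappa> = "\<lambda>v. v"] by (simp add: esym_def lookup_sum lookup_single when_def)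
  also have "\<dots> = (\<Sum>S\<in>?T. if S = Poly_Mapping.keys \<alpha> then (if \<forall>i. Poly_Mapping.lookup \<alpha> i \<le> 1 then 1 else 0) else 0)"
    using e by (intro sum.cong refl) auto
  also have "\<dots> = (if card (Poly_Mapping.keys \<alpha>) = n \<and> (\<forall>i. Poly_Mapping.lookup \<alpha> i \<le> 1) then 1 else 0)"
    using assms \<alpha> by (simp add: sum.delta)
  also have "\<dots> = elem n \<alpha>"
  proof -
    have "(\<Sum>i\<in>Poly_Mapping.keys \<alpha>. Poly_Mapping.lookup \<alpha> i) = card (Poly_Mapping.keys \<alpha>)" if "\<forall>i. Poly_Mapping.lookup \<alpha> i \<le> 1"
    proof -
      have "Poly_Mapping.lookup \<alpha> i = 1" if "i \<in> Poly_Mapping.keys \<alpha>" for i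
        using \<open>\<forall>i. Poly_Mapping.lookup \<alpha> i \<le> 1\<close> that by (metis One_nat_def in_keys_iff le_Suc_eq le_zero_eq)
      then show ?thesis by simp
    qed
    then show ?thesis by (auto simp: elem_def)
  qed
  finally show "Poly_Mapping.lookup (esym C var n) \<alpha> = elem n \<alpha>" .
qed

text \<open>Each \<open>\<beta>\<close> is bounded by \<open>\<alpha>\<close> and vanishes off its
  support. Finiteness keeps the sum in \<open>sf_mult\<close> from taking the default value
  0.\<close>

lemma finite_antidiagonal:
  "finite {(\<beta>, \<gamma>). \<beta> + \<gamma> = (\<alpha> :: nat \<Rightarrow>\<^sub>0 nat)}"
proof -
  let ?A = "{(\<beta>, \<gamma>). \<beta> + \<gamma> = \<alpha>}"
  let ?f = "\<lambda>(\<beta>, \<gamma> :: nat \<Rightarrow>\<^sub>0 nat). restrict (Poly_Mapping.lookup \<beta>) (Poly_Mapping.keys \<alpha>)"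
  have "?f ` ?A \<subseteq> (\<Pi>\<^sub>E i\<in>Poly_Mapping.keys \<alpha>. {..Poly_Mapping.lookup \<alpha> i})"
    by (auto simp: lookup_add)
  then have "finite (?f ` ?A)"
    by (rule finite_subset) (auto intro: finite_PiE)
  moreover have "inj_on ?f ?A"
  proof (rule inj_onI, clarify)
    fix \<beta> \<gamma> \<beta>' \<gamma>' :: "nat \<Rightarrow>\<^sub>0 nat"
    assume eq: "\<beta>' + \<gamma>' = \<beta> + \<gamma>" and \<alpha>: "\<alpha> = \<beta> + \<gamma>"
      and r: "restrict (Poly_Mapping.lookup \<beta>) (Poly_Mapping.keys (\<beta> + \<gamma>)) = restrict (Poly_Mapping.lookup \<beta>') (Poly_Mapping.keys (\<beta> + \<gamma>))"
    have "Poly_Mapping.lookup \<beta> i = Poly_Mapping.lookup \<beta>' i" for i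
    proof (cases "i \<in> Poly_Mapping.keys (\<beta> + \<gamma>)")
      case True
      then show ?thesis using fun_cong[OF r, of i] by simp
    next
      case False
      then have "Poly_Mapping.lookup (\<beta> + \<gamma>) i = 0" "Poly_Mapping.lookup (\<beta>' + \<gamma>') i = 0" by (auto simp: in_keys_iff eq)
      then show ?thesis by (simp add: lookup_add)
    qed
    then have "\<beta> = \<beta>'" by (simp add: poly_mapping_eq_iff fun_eq_iff)
    then show "\<beta> = \<beta>' \<and> \<gamma> = \<gamma>'" using eq by simp
  qed
  ultimately show ?thesis by (rule finite_imageD)
qed

lemma lookup_times_eq_sf_mult: "Poly_Mapping.lookup (P * Q) \<alpha> = sf_mult (Poly_Mapping.lookup P) (Poly_Mapping.lookup Q) \<alpha>"
proof -
  let ?h = "\<lambda>(\<beta>, \<gamma>). Poly_Mapping.lookup P \<beta> * Poly_Mapping.lookup Q \<gamma> when \<alpha> = \<beta> + \<gamma>"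
  have "Poly_Mapping.lookup (P * Q) \<alpha> = Sum_any ?h"
    unfolding times_poly_mapping.rep_eq by (rule prod_fun_unfold_prod) auto
  also have "\<dots> = sum ?h {(\<beta>, \<gamma>). \<beta> + \<gamma> = \<alpha>}"
    by (rule Sum_any.expand_superset[OF finite_antidiagonal]) (auto simp: when_def split: if_splits)
  also have "\<dots> = sf_mult (Poly_Mapping.lookup P) (Poly_Mapping.lookup Q) \<alpha>"
    unfolding sf_mult_def by (intro sum.cong refl) auto
  finally show ?thesis .
qed

text \<open>Both factors of a monomial over \<open>C\<close> are again monomials over
  \<open>C\<close>, so the convolution reads only coefficients on which agreement is known.\<close>

lemma agrees_mult:
  assumes "agrees C P f" "agrees C Q g"
  shows "agrees C (P * Q) (sf_mult f g)"
  unfolding agrees_def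
proof (intro allI impI)
  fix \<alpha> :: "nat \<Rightarrow>\<^sub>0 nat" assume \<alpha>: "Poly_Mapping.keys \<alpha> \<subseteq> C"
  have "Poly_Mapping.keys \<beta> \<subseteq> C" "Poly_Mapping.keys \<gamma> \<subseteq> C" if "\<beta> + \<gamma> = \<alpha>" for \<beta> \<gamma>
    using \<alpha> that by (force simp: in_keys_iff lookup_add)+
  then show "Poly_Mapping.lookup (P * Q) \<alpha> = sf_mult f g \<alpha>"
    using assms unfolding lookup_times_eq_sf_mult sf_mult_def agrees_def
    by (intro sum.cong refl) auto
qed

lemma lookup_of_nat_mult: "Poly_Mapping.lookup (of_nat n * P) \<alpha> = of_nat n * Poly_Mapping.lookup P \<alpha>"
  for P :: "'a::monoid_add \<Rightarrow>\<^sub>0 'b::semiring_1"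
  by (induction n) (simp_all add: distrib_right lookup_add)

section \<open>Comparison of a single coefficient\<close>

theorem theorem5p1:
  fixes G :: "'a graph" and H :: "'b graph" and vG :: 'a and vH :: 'b
    and g h m :: nat
  assumes "simple_graph G" and "simple_graph H"
    and "vG \<in> fst G" and "vH \<in> fst H"
    and "m \<ge> 2"
  shows "\<forall>\<alpha>. csf (Kmgh m g h G vG H vH) \<alpha> / fact (m - 2) =
      (\<Sum>z = 1..m - 1. of_nat z * sf_mult (elem (m - 1 - z)) (csf (Pk (g + h + z) G vG H vH)) \<alpha>)
      + of_nat (m - 2) *
        (\<Sum>(a, b, c) \<in> {(a, b, c). a + b + c = m - 2}.
           (of_nat a - 1) * sf_mult (sf_mult (elem a) (csf (pendant (b + g) G vG)))
                                    (csf (pendant (c + h) H vH)) \<alpha>)"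
proof
  fix \<alpha> :: "nat \<Rightarrow>\<^sub>0 nat"
  \<comment> \<open>The colours occurring in the chosen monomial suffice for its coefficient on both
    sides.\<close>
  define C where "C = Poly_Mapping.keys \<alpha>"
  define n where "n = m - 2"
  have C: "finite C" "Poly_Mapping.keys \<alpha> \<subseteq> C" by (auto simp: C_def)
  have m: "m - 1 = Suc n" "m - 2 = n" using assms(5) by (auto simp: n_def)
  let ?L = "walk_step C var"
  define a where "a = (?L ^^ g) (root_sum G vG C var)"
  define b where "b = (?L ^^ h) (root_sum H vH C var)"
  have fin: "finite (fst G)" "finite (fst H)" using assms by (auto simp: simple_graph_def)
  have fin_Pk: "finite (fst (Pk k G vG H vH))" for k
    using fin by (auto simp: Pk_def Let_def gunion_def gmap_def path_graph_map simp del: upt_Suc)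
  have fin_pendant: "finite (fst (pendant k F u))" if "finite (fst F)" for k and F :: "'c graph" and u
    using that by (auto simp: pendant_def Pk_def Let_def gunion_def gmap_def path_graph_map K1_def simp del: upt_Suc)
  have fin_K: "finite (fst (Kmgh m g h G vG H vH))"
    using fin by (auto simp: Kmgh_def Let_def gunion_def gmap_def path_graph_map simp del: upt_Suc)
  have K: "Poly_Mapping.lookup (of_nat (fact n) * (\<Sum>c\<in>C. \<Sum>d\<in>C - {c}. a c * b d * esym (C - {c, d}) var n)) \<alpha>
      = csf (Kmgh m g h G vG H vH) \<alpha>"
    using agrees_csf[OF fin_K C(1)] C(2)
      col_sum_Kmgh[OF assms(1,3,2,4) C(1) assms(5), of g h var]
    by (simp add: agrees_def a_def b_def m)
  have P: "Poly_Mapping.lookup (esym C var i * off_diag C ((?L ^^ (z - 1)) a) b) \<alpha>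
      = sf_mult (elem i) (csf (Pk (g + h + z) G vG H vH)) \<alpha>" if z: "z \<ge> 1" for i z
  proof -
    obtain k where k: "z = Suc k" using z by (cases z) auto
    \<comment> \<open>\<open>col_sum_Pk\<close> grows the path from \<open>G\<close> alone, so
      self-adjointness moves the \<open>h\<close> steps contained in \<open>b\<close> to the first
      argument; the last edge is \<open>off_diag\<close> itself.\<close>
    have "off_diag C ((?L ^^ k) a) b = col_sum (Pk (Suc (h + k + g)) G vG H vH) C var"
      unfolding col_sum_Pk[OF assms(1,3,2,4) C(1)] a_def b_def off_diag_walk_step_pow[symmetric]
      by (simp add: funpow_add)
    then have "agrees C (off_diag C ((?L ^^ (z - 1)) a) b) (csf (Pk (g + h + z) G vG H vH))"
      using agrees_csf[OF fin_Pk C(1)] by (simp add: k add_ac)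
    from agrees_mult[OF agrees_elem[OF C(1), of i] this] show ?thesis
      using C(2) by (simp add: agrees_def)
  qed
  have Q: "Poly_Mapping.lookup (esym C var i * sum ((?L ^^ j) a) C * sum ((?L ^^ k) b) C) \<alpha>
      = sf_mult (sf_mult (elem i) (csf (pendant (j + g) G vG))) (csf (pendant (k + h) H vH)) \<alpha>" for i j k
  proof -
    have "sum ((?L ^^ j) a) C = col_sum (pendant (j + g) G vG) C var"
      "sum ((?L ^^ k) b) C = col_sum (pendant (k + h) H vH) C var"
      unfolding col_sum_pendant[OF assms(1,3) C(1)] col_sum_pendant[OF assms(2,4) C(1)]
      by (simp_all add: a_def b_def funpow_add)
    then have "agrees C (sum ((?L ^^ j) a) C) (csf (pendant (j + g) G vG))"
      "agrees C (sum ((?L ^^ k) b) C) (csf (pendant (k + h) H vH))"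
      using agrees_csf[OF fin_pendant C(1)] fin by simp_all
    from agrees_mult[OF agrees_mult[OF agrees_elem[OF C(1), of i] this(1)] this(2)] show ?thesis
      using C(2) by (simp add: agrees_def)
  qed
  have "csf (Kmgh m g h G vG H vH) \<alpha> / fact n
      = Poly_Mapping.lookup (\<Sum>c\<in>C. \<Sum>d\<in>C - {c}. a c * b d * esym (C - {c, d}) var n) \<alpha>"
    unfolding K[symmetric] lookup_of_nat_mult by simp
  also have "\<dots> = (\<Sum>z = 1..Suc n. of_nat z * sf_mult (elem (Suc n - z)) (csf (Pk (g + h + z) G vG H vH)) \<alpha>)
      + of_nat n *
        (\<Sum>(i, j, k) \<in> {(i, j, k). i + j + k = n}.
           (of_nat i - 1) * sf_mult (sf_mult (elem i) (csf (pendant (j + g) G vG)))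
                                    (csf (pendant (k + h) H vH)) \<alpha>)"
    unfolding clique_identity[OF C(1)]
    by (simp add: lookup_add lookup_sum lookup_of_nat_mult P Q left_diff_distrib lookup_minus
        case_prod_beta del: sum.cl_ivl_Suc One_nat_def cong: sum.cong_simp)
  finally show "csf (Kmgh m g h G vG H vH) \<alpha> / fact (m - 2) =
      (\<Sum>z = 1..m - 1. of_nat z * sf_mult (elem (m - 1 - z)) (csf (Pk (g + h + z) G vG H vH)) \<alpha>)
      + of_nat (m - 2) *
        (\<Sum>(a, b, c) \<in> {(a, b, c). a + b + c = m - 2}.
           (of_nat a - 1) * sf_mult (sf_mult (elem a) (csf (pendant (b + g) G vG)))
                                    (csf (pendant (c + h) H vH)) \<alpha>)"
    by (simp only: m)
qed

end
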